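(* One has $$\lim_{n\to\infty}\frac{\left|\{S\in\mathcal{A}_n : |P(S)|\cdot|L(S)|\ge F(S)+1\}\right|}{A_n}=1.$$
   Context: $\mathbb{N}$ is the set of nonnegative integers. A numerical semigroup is a subset $S\subseteq\mathbb{N}$ that contains $0$, is closed under addition, and has finite complement in $\mathbb{N}$. Every numerical semigroup $S$ has a unique minimal generating set, which is finite; it is denoted $P(S)$ and its elements are called primitives. For $S\neq\mathbb{N}$ the Frobenius number $F(S)$ is the largest element of $\mathbb{N}\setminus S$; by convention $F(\mathbb{N})=-1$. The set of left elements of $S$ is $L(S)=\{s\in S: s<F(S)\}$. For a positive integer $n$, $\mathcal{A}_n$ denotes the (finite) set of numerical semigroups $S$ with $\max P(S)=n$, and $A_n=|\mathcal{A}_n|$. *)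

theory Defs
  imports Complex_Main
begin

definition add_submonoid :: "nat set \<Rightarrow> bool" where
  "add_submonoid T \<longleftrightarrow> 0 \<in> T \<and> (\<forall>x\<in>T. \<forall>y\<in>T. x + y \<in> T)"

definition numerical_semigroup :: "nat set \<Rightarrow> bool" where
  "numerical_semigroup S \<longleftrightarrow> add_submonoid S \<and> finite (- S)"

definition generates :: "nat set \<Rightarrow> nat set \<Rightarrow> bool" where
  "generates X S \<longleftrightarrow> add_submonoid hull X = S"

definition minimal_generating_set :: "nat set \<Rightarrow> nat set \<Rightarrow> bool" where
  "minimal_generating_set X S \<longleftrightarrow> generates X S \<and> (\<forall>Y. Y \<subset> X \<longrightarrow> \<not> generates Y S)"

text \<open>The definite description denotes a finite set for every numerical semigroup: see
  \<open>ex1_minimal_generating_set\<close> and \<open>finite_primitives\<close> below.\<close>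

definition primitives :: "nat set \<Rightarrow> nat set" where
  "primitives S = (THE X. minimal_generating_set X S)"

definition Frobenius :: "nat set \<Rightarrow> int" where
  "Frobenius S = (if S = UNIV then -1 else int (Max (- S)))"

definition left_elements :: "nat set \<Rightarrow> nat set" where
  "left_elements S = {s \<in> S. int s < Frobenius S}"

definition semigroups_max_prim :: "nat \<Rightarrow> nat set set" where
  "semigroups_max_prim n = {S. numerical_semigroup S \<and> Max (primitives S) = n}"

lemma add_submonoid_hull: "add_submonoid (add_submonoid hull X)"
  by (rule hull_in) (auto simp: add_submonoid_def)

lemma zero_in_hull: "0 \<in> add_submonoid hull X"
  and add_in_hull: "a \<in> add_submonoid hull X \<Longrightarrow> b \<in> add_submonoid hull X \<Longrightarrow>
    a + b \<in> add_submonoid hull X"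
  using add_submonoid_hull[of X] unfolding add_submonoid_def[of "add_submonoid hull X"] by auto

definition irreducible_elements :: "nat set \<Rightarrow> nat set" where
  "irreducible_elements S =
    {s \<in> S. s \<noteq> 0 \<and> \<not> (\<exists>a\<in>S. \<exists>b\<in>S. a \<noteq> 0 \<and> b \<noteq> 0 \<and> s = a + b)}"

lemma irreducible_elements_least_generating:
  assumes "add_submonoid S"
  shows "generates (irreducible_elements S) S"
    and "generates X S \<Longrightarrow> irreducible_elements S \<subseteq> X"
proof -
  define Q where "Q = irreducible_elements S"
  note Q_def = Q_def[unfolded irreducible_elements_def]
  have least: "Q \<subseteq> X" if "generates X S" for X
  proof
    fix q assume q: "q \<in> Q"
    show "q \<in> X"
    proof (rule ccontr)
      assume "q \<notin> X"
      have "X \<subseteq> S" using that hull_subset[of X add_submonoid] by (simp add: generates_def)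
      with \<open>q \<notin> X\<close> have sub: "X \<subseteq> S - {q}" by blast
      have "add_submonoid (S - {q})"
        unfolding add_submonoid_def
      proof (intro conjI ballI)
        show "0 \<in> S - {q}" using q assms by (auto simp: Q_def add_submonoid_def)
        fix x y assume x: "x \<in> S - {q}" and y: "y \<in> S - {q}"
        have "x + y \<in> S" using x y assms by (auto simp: add_submonoid_def)
        moreover have "x + y \<noteq> q"
        proof
          assume "x + y = q"
          moreover from this x y have "x \<noteq> 0" "y \<noteq> 0" by auto
          ultimately show False using q x y unfolding Q_def by blast
        qed
        ultimately show "x + y \<in> S - {q}" by blast
      qed
      then have "add_submonoid hull X \<subseteq> S - {q}" by (rule hull_minimal[OF sub])
      with that q show False by (auto simp: generates_def Q_def)
    qed
  qed
  have "s \<in> add_submonoid hull Q" if "s \<in> S" for s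
    using that
  proof (induction s rule: less_induct)
    case (less s)
    consider "s = 0" | "s \<in> Q" |
      a b where "a \<in> S" "b \<in> S" "a \<noteq> 0" "b \<noteq> 0" "s = a + b"
      using less.prems by (auto simp: Q_def)
    then show ?case
    proof cases
      case 1
      then show ?thesis by (simp add: zero_in_hull)
    next
      case 2
      then show ?thesis by (rule hull_inc)
    next
      case 3
      then have "a \<in> add_submonoid hull Q" "b \<in> add_submonoid hull Q"
        using less.IH[of a] less.IH[of b] by auto
      then show ?thesis using 3 by (simp add: add_in_hull)
    qed
  qed
  moreover have "add_submonoid hull Q \<subseteq> S"
    by (rule hull_minimal) (use assms in \<open>auto simp: Q_def\<close>)
  ultimately have "generates Q S" by (auto simp: generates_def)
  with least show "generates (irreducible_elements S) S"
    and "generates X S \<Longrightarrow> irreducible_elements S \<subseteq> X"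
    unfolding Q_def irreducible_elements_def by blast+
qed

lemma ex1_minimal_generating_set:
  assumes "numerical_semigroup S"
  shows "\<exists>!X. minimal_generating_set X S"
proof -
  have "add_submonoid S" using assms by (simp add: numerical_semigroup_def)
  note Q = irreducible_elements_least_generating[OF this]
  show ?thesis
  proof (rule ex1I)
    show "minimal_generating_set (irreducible_elements S) S"
      unfolding minimal_generating_set_def using Q by blast
    fix X assume X: "minimal_generating_set X S"
    then have "irreducible_elements S \<subseteq> X" using Q(2) by (simp add: minimal_generating_set_def)
    moreover have "\<not> irreducible_elements S \<subset> X" using X Q(1) by (auto simp: minimal_generating_set_def)
    ultimately show "X = irreducible_elements S" by blast
  qed
qed

lemma minimal_generating_set_primitives:
  assumes "numerical_semigroup S"
  shows "minimal_generating_set (primitives S) S"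
  unfolding primitives_def using ex1_minimal_generating_set[OF assms] by (rule theI')

lemma primitives_eq:
  assumes "numerical_semigroup S"
  shows "primitives S = irreducible_elements S"
proof -
  have "add_submonoid S" using assms by (simp add: numerical_semigroup_def)
  note Q = irreducible_elements_least_generating[OF this]
  have "generates (primitives S) S" "\<not> irreducible_elements S \<subset> primitives S"
    using minimal_generating_set_primitives[OF assms] Q(1)
    unfolding minimal_generating_set_def by blast+
  then show ?thesis using Q(2)[of "primitives S"] by blast
qed

lemma finite_primitives:
  assumes "numerical_semigroup S"
  shows "finite (primitives S)"
proof -
  have "finite (- S)" using assms by (simp add: numerical_semigroup_def)
  then obtain N where N: "\<And>x. x \<notin> S \<Longrightarrow> x \<le> N"
    unfolding finite_nat_set_iff_bounded_le by auto
  have "x \<le> 2 * N + 1" if "x \<in> primitives S" for x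
  proof (rule ccontr)
    assume "\<not> x \<le> 2 * N + 1"
    then have x: "x - (N + 1) > N" "x = (N + 1) + (x - (N + 1))" by linarith+
    have "N + 1 \<in> S" using N[of "N + 1"] by linarith
    moreover have "x - (N + 1) \<in> S" using N[of "x - (N + 1)"] x(1) by linarith
    moreover have "x - (N + 1) \<noteq> 0" using x(1) by linarith
    moreover have "N + 1 \<noteq> 0" by simp
    moreover have "\<And>a b. a \<in> S \<Longrightarrow> b \<in> S \<Longrightarrow> a \<noteq> 0 \<Longrightarrow> b \<noteq> 0 \<Longrightarrow> x \<noteq> a + b"
      using that unfolding primitives_eq[OF assms] irreducible_elements_def by blast
    ultimately show False using x(2) by metis
  qed
  then show ?thesis unfolding finite_nat_set_iff_bounded_le by blast
qed

lemma primitives_nonempty: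
  assumes "numerical_semigroup S"
  shows "primitives S \<noteq> {}"
proof
  assume "primitives S = {}"
  then have "S = add_submonoid hull {}"
    using minimal_generating_set_primitives[OF assms]
    by (simp add: minimal_generating_set_def generates_def)
  also have "\<dots> \<subseteq> {0}" by (rule hull_minimal) (auto simp: add_submonoid_def)
  finally have "UNIV - {0} \<subseteq> - S" by blast
  moreover have "finite (- S)" using assms by (simp add: numerical_semigroup_def)
  ultimately have "finite (UNIV - {0::nat})" by (rule finite_subset)
  then show False by simp
qed

lemma finite_semigroups_max_prim: "finite (semigroups_max_prim n)"
proof (rule finite_surj)
  show "finite (Pow {..n})" by simp
  show "semigroups_max_prim n \<subseteq> (\<lambda>X. add_submonoid hull X) ` Pow {..n}"
  proof
    fix S assume "S \<in> semigroups_max_prim n"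
    then have S: "numerical_semigroup S" "Max (primitives S) = n"
      by (auto simp: semigroups_max_prim_def)
    have "primitives S \<subseteq> {..n}" using S finite_primitives[of S] by auto
    moreover have "S = add_submonoid hull primitives S"
      using minimal_generating_set_primitives[OF S(1)]
      by (simp add: minimal_generating_set_def generates_def)
    ultimately show "S \<in> (\<lambda>X. add_submonoid hull X) ` Pow {..n}" by blast
  qed
qed

end

theory Submission
  imports Defs "HOL-Real_Asymp.Real_Asymp"
begin

text \<open>
  If a semigroup \<open>S\<close> with largest primitive \<open>n\<close> has at least \<open>r\<close> primitives, where
  \<open>r\<^sup>2 \<ge> 4 n\<close>, then the translates of the primitives by multiples of \<open>n\<close> give about \<open>r F / n\<close>
  left elements when \<open>F > n\<close>, and Wilf's inequality follows. If \<open>F < n\<close> it suffices that there are at least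
  \<open>r\<close> left elements. Hence a counterexample is determined either by fewer than \<open>r\<close> primitives or
  by \<open>F < n\<close> and fewer than \<open>r\<close> left elements. With \<open>r\<close> about \<open>2 \<surd>n\<close> there are only
  \<open>exp (O (\<surd>n ln n))\<close> such data, whereas any subset of the integers strictly between \<open>n/2\<close> and
  \<open>n - 1\<close>, together with \<open>n - 1\<close> and \<open>n\<close>, is the set of primitives of a numerical semigroup,
  so that \<open>A\<^sub>n\<close> is at least of order \<open>2\<^bsup>n/2\<^esup>\<close>.
\<close>

text \<open>Zeros pad an enumeration of the subset to a list of length exactly \<open>k\<close> over
  \<open>{0..n}\<close>. Since 0 lies outside \<open>{1..n}\<close>, deleting it recovers the
  subset.\<close>

lemma card_small_subsets_le:
  "card {A. A \<subseteq> {1..n} \<and> card A \<le> k} \<le> (n + 1) ^ k"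
proof -
  let ?L = "{xs. set xs \<subseteq> {0..n} \<and> length xs = k}"
  have "{A. A \<subseteq> {1..n} \<and> card A \<le> k} \<subseteq> (\<lambda>xs. set xs - {0}) ` ?L"
  proof
    fix A assume A: "A \<in> {A. A \<subseteq> {1..n} \<and> card A \<le> k}"
    then have "finite A" by (auto intro: finite_subset)
    then obtain ys where ys: "set ys = A" "distinct ys"
      using finite_distinct_list by blast
    let ?xs = "ys @ replicate (k - card A) 0"
    have "length ys = card A" using ys distinct_card by fastforce
    then have "?xs \<in> ?L" using A ys(1) by auto
    moreover have "A = set ?xs - {0}" using A ys(1) by auto
    ultimately show "A \<in> (\<lambda>xs. set xs - {0}) ` ?L" by blast
  qed
  then have "card {A. A \<subseteq> {1..n} \<and> card A \<le> k} \<le> card ?L"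
    by (rule surj_card_le[rotated]) (simp add: finite_lists_length_eq)
  then show ?thesis by (simp add: card_lists_length_eq)
qed

section \<open>Semigroups with a given largest primitive\<close>

lemma add_submonoid_mult: "add_submonoid S \<Longrightarrow> x \<in> S \<Longrightarrow> k * x \<in> S"
  by (induction k) (auto simp: add_submonoid_def)

lemma numerical_semigroup_primitives_hull:
  "numerical_semigroup S \<Longrightarrow> add_submonoid hull (primitives S) = S"
  using minimal_generating_set_primitives[of S]
  by (simp add: minimal_generating_set_def generates_def)

lemma primitives_subset: "numerical_semigroup S \<Longrightarrow> primitives S \<subseteq> S - {0}"
  by (auto simp: primitives_eq irreducible_elements_def)

lemma semigroups_max_primD:
  assumes "S \<in> semigroups_max_prim n"
  shows "numerical_semigroup S" "n \<in> S" "n > 0" "primitives S \<subseteq> {1..n}"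
proof -
  show S: "numerical_semigroup S" using assms by (simp add: semigroups_max_prim_def)
  have n: "n = Max (primitives S)" using assms by (simp add: semigroups_max_prim_def)
  have "n \<in> primitives S"
    unfolding n by (intro Max_in finite_primitives primitives_nonempty S)
  then show "n \<in> S" "n > 0" using primitives_subset[OF S] by auto
  show "primitives S \<subseteq> {1..n}"
    using primitives_subset[OF S] finite_primitives[OF S] n by (auto simp: Suc_le_eq)
qed

lemma irreducible_elements_UNIV: "irreducible_elements UNIV \<subseteq> {1}"
proof
  fix x :: nat assume x: "x \<in> irreducible_elements UNIV"
  show "x \<in> {1}"
  proof (rule ccontr)
    assume "x \<notin> {1}"
    with x have "x - 1 \<noteq> 0" "x = 1 + (x - 1)" by (auto simp: irreducible_elements_def)
    with x show False unfolding irreducible_elements_def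
      by (metis (mono_tags, lifting) UNIV_I mem_Collect_eq one_neq_zero)
  qed
qed

text \<open>The only primitive of the full set of naturals is 1, so \<open>n \<ge> 2\<close>
  excludes the conventional value -1 of \<open>Frobenius\<close>.\<close>

lemma Frobenius_semigroups_max_prim:
  assumes "S \<in> semigroups_max_prim n" "n \<ge> 2"
  obtains f where "Frobenius S = int f" "f \<notin> S" "\<And>x. x > f \<Longrightarrow> x \<in> S" "f > 0"
proof -
  note S = semigroups_max_primD[OF assms(1)]
  have "numerical_semigroup UNIV" by (simp add: numerical_semigroup_def add_submonoid_def)
  then have "primitives UNIV \<subseteq> {1}" "primitives UNIV \<noteq> {}"
    using irreducible_elements_UNIV primitives_nonempty by (simp_all add: primitives_eq)
  then have "primitives UNIV = {1}" by (simp add: subset_singleton_iff)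
  then have "Max (primitives UNIV) = 1" by simp
  moreover have "Max (primitives S) = n" using assms(1) by (simp add: semigroups_max_prim_def)
  ultimately have ne: "S \<noteq> UNIV" using assms(2) by auto
  have fin: "finite (- S)" using S(1) by (simp add: numerical_semigroup_def)
  define f where "f = Max (- S)"
  have "f \<in> - S" unfolding f_def using ne fin by (intro Max_in) auto
  then have f: "f \<notin> S" by simp
  show ?thesis
  proof (rule that)
    show "Frobenius S = int f" using ne by (simp add: Frobenius_def f_def)
    show "f \<notin> S" by (rule f)
    show "x \<in> S" if "x > f" for x
      using that Max_ge[OF fin, of x] unfolding f_def by (meson ComplI not_le)
    have "0 \<in> S" using S(1) by (simp add: numerical_semigroup_def add_submonoid_def)
    then show "f > 0" using f by (metis gr0I)
  qed
qed

section \<open>Wilf's inequality from many primitives\<close>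

lemma card_primitives_translates_le:
  assumes "S \<in> semigroups_max_prim n" "int (q * n) < Frobenius S"
  shows "card (primitives S) * q \<le> card (left_elements S)"
proof -
  note S = semigroups_max_primD[OF assms(1)]
  have sub: "add_submonoid S" using S(1) by (simp add: numerical_semigroup_def)
  let ?g = "\<lambda>(p, k). p + k * n"
  \<comment> \<open>Division of \<open>p + k * n - 1\<close> by \<open>n\<close> has quotient
    \<open>k\<close> and remainder \<open>p - 1\<close>, because
    \<open>1 \<le> p \<le> n\<close>.\<close>
  have "inj_on ?g ({1..n} \<times> {..<q})"
  proof (rule inj_onI, clarify)
    fix p k p' k'
    assume "p \<in> {1..n}" "p' \<in> {1..n}" and eq: "p + k * n = p' + k' * n"
    then obtain i i' where i: "p = Suc i" "p' = Suc i'" "i < n" "i' < n"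
      by (cases p; cases p') auto
    then have "i + k * n = i' + k' * n" using eq by simp
    then have "(i + k * n) mod n = (i' + k' * n) mod n" "(i + k * n) div n = (i' + k' * n) div n"
      by simp_all
    then show "p = p' \<and> k = k'" using i by simp
  qed
  then have inj: "inj_on ?g (primitives S \<times> {..<q})"
    by (rule inj_on_subset) (use S(4) in auto)
  have "?g ` (primitives S \<times> {..<q}) \<subseteq> left_elements S"
  proof clarify
    fix p k assume p: "p \<in> primitives S" and "k < q"
    then have "Suc k * n \<le> q * n" by (intro mult_le_mono1) simp
    moreover have "p \<le> n" using p S(4) by auto
    ultimately have "p + k * n \<le> q * n" by simp
    then have "int (p + k * n) < Frobenius S" using assms(2) by linarith
    moreover have "p + k * n \<in> S"
      using sub p primitives_subset[OF S(1)] add_submonoid_mult[OF sub S(2)]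
      by (auto simp: add_submonoid_def)
    ultimately show "p + k * n \<in> left_elements S" by (simp add: left_elements_def)
  qed
  moreover have "finite (left_elements S)"
    by (rule finite_subset[of _ "{..nat (Frobenius S)}"]) (auto simp: left_elements_def)
  ultimately have "card (?g ` (primitives S \<times> {..<q})) \<le> card (left_elements S)"
    by (rule card_mono[rotated])
  then show ?thesis by (simp add: card_image[OF inj] card_cartesian_product)
qed

text \<open>The translates yield nothing when the Frobenius number is below \<open>n\<close>; in
  that range a lower bound on the left elements has to be assumed.\<close>

lemma Wilf_inequality_of_many_primitives:
  assumes "S \<in> semigroups_max_prim n" "n \<ge> 2" "r\<^sup>2 \<ge> 4 * n" "r \<le> card (primitives S)"
    and "Frobenius S < int n \<Longrightarrow> r \<le> card (left_elements S)"
  shows "Frobenius S + 1 \<le> int (card (primitives S) * card (left_elements S))"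
proof -
  note S = semigroups_max_primD[OF assms(1)]
  obtain f where f: "Frobenius S = int f" "f \<notin> S"
    using Frobenius_semigroups_max_prim[OF assms(1,2)] by metis
  have "f + 1 \<le> card (primitives S) * card (left_elements S)"
  proof (cases "f < n")
    case True
    then have "r * r \<le> card (primitives S) * card (left_elements S)"
      using assms(4,5) f by (intro mult_le_mono) auto
    then show ?thesis using assms(3) True by (simp add: power2_eq_square)
  next
    case False
    \<comment> \<open>Equality is impossible, as \<open>n\<close> lies in \<open>S\<close> and
      \<open>f\<close> does not.\<close>
    with f S(2) have "f > n" by (metis nat_neq_iff)
    \<comment> \<open>This is the largest \<open>q\<close> with \<open>q * n < f\<close>. The 4 in
      \<open>r\<^sup>2 \<ge> 4 * n\<close> pays for two losses of a factor 2: replacing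
      \<open>q + 1\<close> by \<open>2 * q\<close>, and absorbing the additive 1 in
      \<open>2 * (q * n) + 1\<close>.\<close>
    define q where "q = (f - 1) div n"
    have "q \<ge> 1" using \<open>f > n\<close> S(3) by (simp add: q_def Suc_le_eq div_greater_zero_iff)
    have "q * n \<le> f - 1" by (simp add: q_def)
    then have "int (q * n) < Frobenius S" using f \<open>f > n\<close> by linarith
    note le = card_primitives_translates_le[OF assms(1) this]
    have "f - 1 < (q + 1) * n"
      unfolding q_def using S(3) dividend_less_div_times[of n "f - 1"] by (simp add: algebra_simps)
    also have "\<dots> \<le> (2 * q) * n" using \<open>q \<ge> 1\<close> by (intro mult_le_mono1) simp
    finally have "f + 1 \<le> 2 * (q * n) + 1" using \<open>f > n\<close> by simp
    also have "\<dots> \<le> 4 * (q * n)" using \<open>q \<ge> 1\<close> S(3) by (simp add: Suc_le_eq)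
    also have "\<dots> \<le> r\<^sup>2 * q" using mult_le_mono1[OF assms(3), of q] by (simp add: algebra_simps)
    also have "\<dots> = r * (r * q)" by (simp add: power2_eq_square)
    also have "\<dots> \<le> card (primitives S) * (card (primitives S) * q)"
      using assms(4) by (intro mult_le_mono) auto
    also have "\<dots> \<le> card (primitives S) * card (left_elements S)" using le by (intro mult_le_mono) auto
    finally show ?thesis .
  qed
  then have "int (f + 1) \<le> int (card (primitives S) * card (left_elements S))"
    by (simp only: of_nat_le_iff)
  then show ?thesis using f by simp
qed

section \<open>Counting the possible counterexamples\<close>

lemma card_few_primitives_le:
  "card {S \<in> semigroups_max_prim n. card (primitives S) \<le> k} \<le> (n + 1) ^ k"
proof -
  let ?B = "{S \<in> semigroups_max_prim n. card (primitives S) \<le> k}"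
  have "inj_on primitives ?B"
    by (rule inj_onI)
      (metis (mono_tags, lifting) mem_Collect_eq numerical_semigroup_primitives_hull
        semigroups_max_primD(1))
  then have "card ?B \<le> card {A. A \<subseteq> {1..n} \<and> card A \<le> k}"
    by (rule card_inj_on_le) (use semigroups_max_primD(4) in auto)
  also note card_small_subsets_le
  finally show ?thesis .
qed

text \<open>Everything above the Frobenius number belongs to \<open>S\<close>, so that number and
  the nonzero left elements determine \<open>S\<close>. There are at most \<open>n\<close> choices
  for the former, and the latter form a small subset of \<open>{1..n}\<close>.\<close>

lemma card_few_left_elements_le:
  assumes "n \<ge> 2"
  shows "card {S \<in> semigroups_max_prim n. Frobenius S < int n \<and> card (left_elements S) \<le> k}
    \<le> n * (n + 1) ^ k"
proof -
  let ?B = "{S \<in> semigroups_max_prim n. Frobenius S < int n \<and> card (left_elements S) \<le> k}"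
  let ?g = "\<lambda>S. (nat (Frobenius S), left_elements S - {0})"
  let ?T = "{..<n} \<times> {A. A \<subseteq> {1..n} \<and> card A \<le> k}"
  have "inj_on ?g ?B"
  proof (rule inj_onI)
    fix S T assume ST: "S \<in> ?B" "T \<in> ?B" and eq: "?g S = ?g T"
    obtain f where f: "Frobenius S = int f" "f \<notin> S" "\<And>x. x > f \<Longrightarrow> x \<in> S"
      using Frobenius_semigroups_max_prim[of S n] ST assms by blast
    obtain g where g: "Frobenius T = int g" "g \<notin> T" "\<And>x. x > g \<Longrightarrow> x \<in> T"
      using Frobenius_semigroups_max_prim[of T n] ST assms by blast
    have "f = g" using eq f g by simp
    have 0: "0 \<in> S" "0 \<in> T"
      using ST semigroups_max_primD(1)[of _ n]
      by (auto simp: numerical_semigroup_def add_submonoid_def)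
    show "S = T"
    proof (rule set_eqI)
      fix x
      consider "x = 0" | "x > f" | "x = f" | "x < f" "x \<noteq> 0" by linarith
      then show "x \<in> S \<longleftrightarrow> x \<in> T"
      proof cases
        case 4
        then have "x \<in> S \<longleftrightarrow> x \<in> left_elements S - {0}" "x \<in> T \<longleftrightarrow> x \<in> left_elements T - {0}"
          using f g \<open>f = g\<close> by (auto simp: left_elements_def)
        then show ?thesis using eq by blast
      qed (use f g \<open>f = g\<close> 0 in auto)
    qed
  qed
  moreover have "?g ` ?B \<subseteq> ?T"
  proof (rule image_subsetI)
    fix S assume S: "S \<in> ?B"
    have "card (left_elements S - {0}) \<le> card (left_elements S)"
      by (cases "0 \<in> left_elements S") (simp_all add: card_Diff_singleton)
    then show "?g S \<in> ?T" using S assms by (auto simp: left_elements_def)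
  qed
  moreover have fin: "finite {A. A \<subseteq> {1..n} \<and> card A \<le> k}"
    by (rule finite_subset[of _ "Pow {1..n}"]) auto
  ultimately have "card ?B \<le> card ?T"
    by (intro card_inj_on_le) (simp_all add: finite_cartesian_product)
  also have "\<dots> \<le> n * (n + 1) ^ k"
    using card_small_subsets_le[of n k] by (simp add: card_cartesian_product)
  finally show ?thesis .
qed

section \<open>Lower bound for the number of semigroups\<close>

lemma finite_Compl_add_submonoid:
  assumes "add_submonoid S" "a \<in> S" "a + 1 \<in> S" "a > 0"
  shows "finite (- S)"
proof -
  \<comment> \<open>Such an \<open>x\<close> has \<open>x mod a \<le> x div a\<close>, hence is the
    sum of \<open>x mod a\<close> copies of \<open>a + 1\<close> and
    \<open>x div a - x mod a\<close> copies of \<open>a\<close>.\<close>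
  have "x \<in> S" if "x \<ge> a * a" for x
  proof -
    have "x mod a < a" using assms(4) by simp
    moreover have "a \<le> x div a" using that assms(4) by (simp add: less_eq_div_iff_mult_less_eq)
    ultimately have le: "x mod a \<le> x div a" by simp
    have "(x div a - x mod a) * a + (x mod a) * (a + 1) = (x div a - x mod a + x mod a) * a + x mod a"
      by (simp only: distrib_right distrib_left mult_1_right add.assoc)
    also have "\<dots> = x" using le by simp
    finally show ?thesis
      using add_submonoid_mult[OF assms(1,2)] add_submonoid_mult[OF assms(1,3)] assms(1)
      unfolding add_submonoid_def by metis
  qed
  then have "- S \<subseteq> {..<a * a}" by (metis ComplD lessThan_iff not_le subsetI)
  then show ?thesis by (rule finite_subset) simp
qed

text \<open>Two nonzero elements of \<open>S\<close> sum to at least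
  \<open>2 * (n div 2 + 1) > n\<close>, so no element of \<open>X\<close> decomposes. The
  consecutive elements \<open>n - 1\<close> and \<open>n\<close> make the complement finite.\<close>

lemma primitives_hull_upper_half:
  assumes "X \<subseteq> {n div 2 + 1..n}" "n - 1 \<in> X" "n \<in> X" "n \<ge> 2"
  defines "S \<equiv> add_submonoid hull X"
  shows "numerical_semigroup S" "primitives S = X"
proof -
  have sub: "add_submonoid S" unfolding S_def by (rule add_submonoid_hull)
  have X: "X \<subseteq> S" unfolding S_def by (rule hull_subset)
  have "finite (- S)"
    by (rule finite_Compl_add_submonoid[OF sub, of "n - 1"]) (use X assms(2-4) in auto)
  with sub show S: "numerical_semigroup S" by (simp add: numerical_semigroup_def)
  have "S \<subseteq> {0} \<union> {n div 2 + 1..}" unfolding S_def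
    by (rule hull_minimal) (use assms(1) in \<open>auto simp: add_submonoid_def\<close>)
  then have big: "x \<ge> n div 2 + 1" if "x \<in> S" "x \<noteq> 0" for x using that by auto
  have "X \<subseteq> irreducible_elements S"
  proof
    fix x assume x: "x \<in> X"
    have "x \<noteq> a + b" if "a \<in> S" "b \<in> S" "a \<noteq> 0" "b \<noteq> 0" for a b
      using big[OF that(1,3)] big[OF that(2,4)] x assms(1) by fastforce
    then show "x \<in> irreducible_elements S"
      using x X assms(1) by (auto simp: irreducible_elements_def)
  qed
  moreover have "irreducible_elements S \<subseteq> X"
    by (rule irreducible_elements_least_generating(2)[OF sub]) (simp add: generates_def S_def)
  ultimately show "primitives S = X" by (simp add: primitives_eq[OF S])
qed

text \<open>Subsets of \<open>{n div 2 + 1..n - 2}\<close> can be chosen freely, and each is read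
  off from the primitives of its semigroup. From \<open>n = 3\<close> on, \<open>n - 1\<close>
  itself lies in the upper half.\<close>

lemma card_semigroups_max_prim_ge:
  assumes "n \<ge> 3"
  shows "2 ^ (n - 2 - n div 2) \<le> card (semigroups_max_prim n)"
proof -
  let ?I = "{n div 2 + 1..n - 2}"
  let ?g = "\<lambda>X. add_submonoid hull (X \<union> {n - 1, n})"
  have g: "numerical_semigroup (?g X)" "primitives (?g X) = X \<union> {n - 1, n}" if "X \<subseteq> ?I" for X
    by (rule primitives_hull_upper_half[where n = n]; use that assms in fastforce)+
  have "inj_on ?g (Pow ?I)"
  proof (rule inj_onI)
    fix X Y assume XY: "X \<in> Pow ?I" "Y \<in> Pow ?I" "?g X = ?g Y"
    then have "X \<union> {n - 1, n} = Y \<union> {n - 1, n}" using g(2) by (metis PowD)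
    moreover have "X \<inter> {n - 1, n} = {}" "Y \<inter> {n - 1, n} = {}"
      using XY assms by fastforce+
    ultimately show "X = Y" by blast
  qed
  moreover have "?g ` Pow ?I \<subseteq> semigroups_max_prim n"
  proof (rule image_subsetI)
    fix X assume "X \<in> Pow ?I"
    then have X: "X \<subseteq> ?I" by simp
    then have "finite (X \<union> {n - 1, n})" "\<And>x. x \<in> X \<union> {n - 1, n} \<Longrightarrow> x \<le> n"
      by (auto intro: finite_subset) (use subsetD in fastforce)
    then have "Max (X \<union> {n - 1, n}) = n" by (intro Max_eqI) simp_all
    with g[OF X] show "?g X \<in> semigroups_max_prim n" by (simp add: semigroups_max_prim_def)
  qed
  ultimately have "card (Pow ?I) \<le> card (semigroups_max_prim n)"
    by (rule card_inj_on_le) (rule finite_semigroups_max_prim)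
  then show ?thesis by (simp add: card_Pow)
qed

section \<open>Counterexamples are negligible\<close>

lemma card_not_Wilf_le:
  assumes "n \<ge> 2" "r\<^sup>2 \<ge> 4 * n"
  shows "card {S \<in> semigroups_max_prim n.
      \<not> int (card (primitives S) * card (left_elements S)) \<ge> Frobenius S + 1} \<le> (n + 1) ^ (r + 1)"
    (is "card ?B \<le> _")
proof -
  let ?P = "{S \<in> semigroups_max_prim n. card (primitives S) \<le> r}"
  let ?L = "{S \<in> semigroups_max_prim n. Frobenius S < int n \<and> card (left_elements S) \<le> r}"
  have "?B \<subseteq> ?P \<union> ?L"
    using Wilf_inequality_of_many_primitives[OF _ assms] by fastforce
  then have "card ?B \<le> card (?P \<union> ?L)"
    by (rule card_mono[rotated]) (simp add: finite_semigroups_max_prim)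
  also have "\<dots> \<le> card ?P + card ?L" by (rule card_Un_le)
  also have "\<dots> \<le> (n + 1) ^ r + n * (n + 1) ^ r"
    by (intro add_mono card_few_primitives_le card_few_left_elements_le assms)
  also have "\<dots> = (n + 1) ^ (r + 1)" by simp
  finally show ?thesis .
qed

theorem theorem1p7:
  shows "(\<lambda>n. real (card {S \<in> semigroups_max_prim n.
              int (card (primitives S) * card (left_elements S)) \<ge> Frobenius S + 1})
            / real (card (semigroups_max_prim n))) \<longlonglongrightarrow> 1"
    (is "(\<lambda>n. real (card {S \<in> _. ?W S}) / _) \<longlonglongrightarrow> 1")
proof -
  let ?A = "\<lambda>n. real (card (semigroups_max_prim n))"
  let ?G = "\<lambda>n. real (card {S \<in> semigroups_max_prim n. ?W S})"
  \<comment> \<open>A bound for the proportion of counterexamples: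
    \<open>r + 1 \<le> 2 * sqrt n + 2\<close> when \<open>r\<close> is \<open>2 * sqrt n\<close>
    rounded up, and \<open>n - 2 - n div 2 \<ge> n / 2 - 2\<close>. Real powers make it accessible
    to \<open>real_asymp\<close>.\<close>
  let ?e = "\<lambda>n::nat. (real n + 1) powr (2 * sqrt (real n) + 2) / 2 powr (real n / 2 - 2)"
  have lower: "1 - ?e n \<le> ?G n / ?A n" if n: "n \<ge> 3" for n
  proof -
    define r where "r = nat \<lceil>2 * sqrt (real n)\<rceil>"
    have r: "2 * sqrt (real n) \<le> real r" "real r \<le> 2 * sqrt (real n) + 1"
      unfolding r_def by (simp_all add: of_nat_ceiling)
    have "(2 * sqrt (real n))\<^sup>2 \<le> (real r)\<^sup>2" using r by (intro power_mono) auto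
    then have "real (4 * n) \<le> real (r\<^sup>2)" by (simp add: power_mult_distrib)
    then have r2: "4 * n \<le> r\<^sup>2" by (simp only: of_nat_le_iff)
    let ?N = "{S \<in> semigroups_max_prim n. \<not> ?W S}"
    have "card (semigroups_max_prim n) = card ({S \<in> semigroups_max_prim n. ?W S} \<union> ?N)"
      by (rule arg_cong[where f = card]) blast
    also have "\<dots> = card {S \<in> semigroups_max_prim n. ?W S} + card ?N"
      by (rule card_Un_disjoint) (auto simp: finite_semigroups_max_prim)
    finally have split: "?A n = ?G n + real (card ?N)" by linarith
    have "real (card ?N) \<le> real ((n + 1) ^ (r + 1))"
      using card_not_Wilf_le[OF _ r2] n by (intro of_nat_mono) simp
    also have "\<dots> = (real n + 1) ^ (r + 1)" by (simp only: of_nat_power of_nat_add of_nat_1)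
    also have "\<dots> = (real n + 1) powr real (r + 1)" by (rule powr_realpow[symmetric]) simp
    also have "\<dots> \<le> (real n + 1) powr (2 * sqrt (real n) + 2)"
      using r by (intro powr_mono) auto
    finally have N: "real (card ?N) \<le> (real n + 1) powr (2 * sqrt (real n) + 2)" .
    have "real n / 2 - 2 \<le> real (n - 2 - n div 2)" using n by linarith
    then have "2 powr (real n / 2 - 2) \<le> 2 powr real (n - 2 - n div 2)" by simp
    also have "\<dots> = real (2 ^ (n - 2 - n div 2))" by (simp add: powr_realpow)
    also have "\<dots> \<le> ?A n" by (intro of_nat_mono card_semigroups_max_prim_ge n)
    finally have A: "2 powr (real n / 2 - 2) \<le> ?A n" .
    then have pos: "?A n > 0" by (rule less_le_trans[rotated]) simp
    have "real (card ?N) / ?A n \<le> ?e n" by (rule frac_le) (use N A in auto)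
    moreover have "?G n / ?A n = 1 - real (card ?N) / ?A n"
      using pos split by (simp add: field_simps)
    ultimately show ?thesis by linarith
  qed
  \<comment> \<open>This includes \<open>n = 0\<close>, where both counts vanish and the quotient is
    0 by convention.\<close>
  have upper: "?G n / ?A n \<le> 1" for n
    by (intro divide_le_eq_1[THEN iffD2])
      (use card_mono[OF finite_semigroups_max_prim, of "{S \<in> semigroups_max_prim n. ?W S}" n] in auto)
  have "(\<lambda>n. 1 - ?e n) \<longlonglongrightarrow> 1" by real_asymp
  then show ?thesis
    by (rule tendsto_sandwich[rotated 2, OF _ tendsto_const])
      (use lower upper in \<open>auto simp: eventually_at_top_linorder\<close>)
qed

end
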